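(* Consider all instances $\mathcal G=(m,A,\boldsymbol r,\boldsymbol\tau,u)$ of the stateless mean field game with exponential discounting $u(r,t)=re^{-\beta t}$ ($\beta>0$) whose sojourn-time function $\boldsymbol\tau$ is continuous and rate monotonous. For every $M>1$, the price of anarchy restricted to those instances with characteristic number $\chi(\mathcal G)=M$ equals $M+1$, i.e., $$\sup\Big\{\frac{\mathrm{SW}(\boldsymbol\mu^* )}{\mathrm{SW}(\boldsymbol\mu^\dagger)}\ \Big|\ \chi(\mathcal G)=M,\ \boldsymbol\mu^*\in\mathcal O(\mathcal G),\ \boldsymbol\mu^\dagger\in\mathcal S(\mathcal G)\Big\}=M+1.$$
   Context: Game data: a total mass $m>0$ of nonatomic agents; a finite action set $A=\{1,\dots,n\}$, $n\ge2$; rewards $\boldsymbol r=(r_i)_{i\in A}$, $r_i>0$; for $s>0$ put $\mathcal U_s(A)=\{\boldsymbol\mu\in\mathbb R_{\ge0}^n\mid\sum_{i\in A}\mu_i=s\}$; sojourn-time functions $\tau_i:\bigcup_{s>0}\mathcal U_s(A)\to(0,\infty)$, $\boldsymbol\tau=(\tau_i)_{i\in A}$; a utility function $u(r,t)$ (present value of reward $r$ received at time $t$). The action rates are $x_i(\boldsymbol\mu)=\mu_i/\tau_i(\boldsymbol\mu)$. Continuous and rate monotonous: $\boldsymbol\tau$ is continuous on each $\mathcal U_s(A)$, and for all $\boldsymbol\mu,\boldsymbol\mu'\in\bigcup_{s>0}\mathcal U_s(A)$ and all $i\in A$, $x_i(\boldsymbol\mu)<x_i(\boldsymbol\mu')$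 implies $\tau_i(\boldsymbol\mu)\le\tau_i(\boldsymbol\mu')$. Characteristic number: $\chi_i(\mathcal G)=\sup_{\boldsymbol\mu\in\mathcal U_m(A)}\dfrac{e^{\beta\tau_i(\boldsymbol\mu)}-1}{\beta\tau_i(\boldsymbol\mu)}$ and $\chi(\mathcal G)=\max_{i\in A}\chi_i(\mathcal G)$. Strategies: $\mathcal P(A)$ is the set of probability vectors on $A$. A strategy is a sequence $\boldsymbol\sigma=(\sigma_k)_{k\ge1}\in\mathcal P(A)^{\mathbb N}$; the $k$th action $a_k$ is drawn from $\sigma_k$, independently over $k$. It is stationary if $\sigma_k$ does not depend on $k$ (then identified with an element of $\mathcal P(A)$). Given a vector of sojourn times $\boldsymbol\tau=(\tau_i)_{i\in A}$, the expected total utility is $$V(\boldsymbol\sigma,\boldsymbol\tau)=\mathbb E_{\boldsymbol\sigma}\Big[\sum_{k=1}^\infty u\Big(r_{a_k},\sum_{j=1}^k\tau_{a_j}\Big)\Big].$$ Stationary equilibrium: a mass distribution $\boldsymbol\mu^\dagger\in\mathcal U_m(A)$ for which there is $\sigma^\dagger\in\mathcal P(A)$ such that (a) $\mu_i^\dagger=\theta\,\sigma^\dagger(i)\,\tau_i(\boldsymbol\mu^\dagger)$ for all $i\in A$, for some normalizing constant $\theta$, and (b) $V(\sigma^\dagger,\boldsymbol\tau(\boldsymbol\mu^\dagger))=\sup_{\boldsymbol\sigma\in\mathcal P(A)^{\mathbb N}}V(\boldsymbol\sigma,\boldsymbol\tau(\boldsymbol\mu^\dagger))$. $\mathcal S(\mathcal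 G)$ is the set of stationary equilibria. Social welfare: $\mathrm{SW}(\boldsymbol\mu)=\sum_{i\in A}r_ix_i(\boldsymbol\mu)$, and $\mathcal O(\mathcal G)=\arg\max\{\mathrm{SW}(\boldsymbol\mu)\mid\boldsymbol\mu\in\bigcup_{0<m'\le m}\mathcal U_{m'}(A)\}$. *)

theory Defs
  imports "HOL-Probability.Probability"
begin

record game =
  mass :: real
  num_actions :: nat
  reward :: "nat \<Rightarrow> real"
  sojourn :: "nat \<Rightarrow> (nat \<Rightarrow> real) \<Rightarrow> real"
  util :: "real \<Rightarrow> real \<Rightarrow> real"

definition actions :: "game \<Rightarrow> nat set" where
  "actions G = {1..num_actions G}"

text \<open>Vectors indexed by the actions are functions vanishing off the action set, so that
  the product topology on \<^typ>\<open>nat \<Rightarrow> real\<close> restricts to the Euclidean topology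
  on mass distributions. The values of \<^const>\<open>sojourn\<close> at other functions are irrelevant.\<close>

definition mass_dists :: "game \<Rightarrow> real \<Rightarrow> (nat \<Rightarrow> real) set" where
  "mass_dists G s = {\<mu>. (\<forall>i\<in>actions G. 0 \<le> \<mu> i) \<and> (\<forall>i. i \<notin> actions G \<longrightarrow> \<mu> i = 0)
                        \<and> (\<Sum>i\<in>actions G. \<mu> i) = s}"

definition all_mass_dists :: "game \<Rightarrow> (nat \<Rightarrow> real) set" where
  "all_mass_dists G = (\<Union>s\<in>{0<..}. mass_dists G s)"

definition valid_game :: "game \<Rightarrow> bool" where
  "valid_game G \<longleftrightarrow> mass G > 0 \<and> num_actions G \<ge> 2 \<and> (\<forall>i\<in>actions G. reward G i > 0)
     \<and> (\<forall>i\<in>actions G. \<forall>\<mu>\<in>all_mass_dists G. sojourn G i \<mu> > 0)"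

definition action_rate :: "game \<Rightarrow> nat \<Rightarrow> (nat \<Rightarrow> real) \<Rightarrow> real" where
  "action_rate G i \<mu> = \<mu> i / sojourn G i \<mu>"

definition continuous_sojourn :: "game \<Rightarrow> bool" where
  "continuous_sojourn G \<longleftrightarrow>
     (\<forall>s>0. \<forall>i\<in>actions G. continuous_on (mass_dists G s) (sojourn G i))"

definition rate_monotonous :: "game \<Rightarrow> bool" where
  "rate_monotonous G \<longleftrightarrow>
     (\<forall>\<mu>\<in>all_mass_dists G. \<forall>\<mu>'\<in>all_mass_dists G. \<forall>i\<in>actions G.
        action_rate G i \<mu> < action_rate G i \<mu>' \<longrightarrow> sojourn G i \<mu> \<le> sojourn G i \<mu>')"

definition exp_discounting :: "real \<Rightarrow> real \<Rightarrow> real \<Rightarrow> real" where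
  "exp_discounting \<beta> r t = r * exp (- \<beta> * t)"

definition char_number_action :: "real \<Rightarrow> game \<Rightarrow> nat \<Rightarrow> ereal" where
  "char_number_action \<beta> G i =
     (SUP \<mu>\<in>mass_dists G (mass G).
        ereal ((exp (\<beta> * sojourn G i \<mu>) - 1) / (\<beta> * sojourn G i \<mu>)))"

definition char_number :: "real \<Rightarrow> game \<Rightarrow> ereal" where
  "char_number \<beta> G = (MAX i\<in>actions G. char_number_action \<beta> G i)"

definition mixed_actions :: "game \<Rightarrow> nat pmf set" where
  "mixed_actions G = {p. set_pmf p \<subseteq> actions G}"

text \<open>Rounds are numbered from 0.\<close>

definition strategies :: "game \<Rightarrow> (nat \<Rightarrow> nat pmf) set" where
  "strategies G = {\<sigma>. \<forall>k. \<sigma> k \<in> mixed_actions G}"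

text \<open>The \<^term>\<open>suminf\<close> and the Bochner integral below take junk values where they fail to
  converge; for exponential discounting with positive sojourn times on the finite action set, the
  series converges almost surely to a bounded random variable.\<close>

definition total_utility :: "game \<Rightarrow> (nat \<Rightarrow> nat pmf) \<Rightarrow> (nat \<Rightarrow> real) \<Rightarrow> real" where
  "total_utility G \<sigma> t =
     (\<integral>a. (\<Sum>k. util G (reward G (a k)) (\<Sum>j\<le>k. t (a j)))
        \<partial>(\<Pi>\<^sub>M k\<in>UNIV. measure_pmf (\<sigma> k)))"

definition stationary_equilibria :: "game \<Rightarrow> (nat \<Rightarrow> real) set" where
  "stationary_equilibria G = {\<mu> \<in> mass_dists G (mass G). \<exists>p\<in>mixed_actions G.
     (\<exists>\<theta>. \<forall>i\<in>actions G. \<mu> i = \<theta> * pmf p i * sojourn G i \<mu>) \<and>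
     ereal (total_utility G (\<lambda>_. p) (\<lambda>i. sojourn G i \<mu>))
       = (SUP \<sigma>\<in>strategies G. ereal (total_utility G \<sigma> (\<lambda>i. sojourn G i \<mu>)))}"

definition social_welfare :: "game \<Rightarrow> (nat \<Rightarrow> real) \<Rightarrow> real" where
  "social_welfare G \<mu> = (\<Sum>i\<in>actions G. reward G i * action_rate G i \<mu>)"

definition social_optima :: "game \<Rightarrow> (nat \<Rightarrow> real) set" where
  "social_optima G =
     {\<mu>. is_arg_max (social_welfare G) (\<lambda>\<nu>. \<nu> \<in> (\<Union>s\<in>{0<..mass G}. mass_dists G s)) \<mu>}"

end

theory Submission
  imports Defs "HOL-Real_Asymp.Real_Asymp"
begin

text \<open>Against fixed sojourn times, action \<open>i\<close> played forever is worth
  \<open>r\<^sub>i / (exp (\<beta> \<tau>\<^sub>i) - 1)\<close>; if \<open>w\<close> is the largest of these values, the utility of every path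
  telescopes to at most \<open>w\<close>, and only actions of value \<open>w\<close> carry mass in equilibrium. Hence
  equilibrium welfare is at least \<open>w \<beta> m\<close>. Compare with an optimum action by action: where the rate
  does not increase, the welfare is already collected in equilibrium; where it increases, rate
  monotonicity makes the sojourn time no shorter, so the welfare is at most \<open>w \<beta> M\<close> per unit of
  mass. This gives the factor \<open>1 + M\<close>. It is approached by two actions, one with a congestible
  sojourn time whose rate saturates at a small mass, the other with a constant sojourn time of
  characteristic number \<open>M\<close>: in equilibrium everybody queues for the first.\<close>

section \<open>Discounted utility\<close>

text \<open>With \<open>E\<close> the accumulated discount factor, the hypothesis on
  \<open>r\<close> bounds every term after the first by \<open>w\<close> times a decrease of
  \<open>E\<close>, so these terms telescope. The term of round 0 is kept exact: the bound still
  depends on the first action, which later separates best actions from worse ones.\<close>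

lemma discounted_sum_le:
  fixes r t :: "nat \<Rightarrow> real" and w \<beta> :: real
  assumes w: "0 \<le> w" and r0: "\<And>k. 0 \<le> r k" and r: "\<And>k. r k \<le> w * (exp (\<beta> * t k) - 1)"
  defines "f \<equiv> \<lambda>k. r k * exp (- \<beta> * (\<Sum>j\<le>k. t j))"
  shows "suminf f \<le> (r 0 + w) * exp (- \<beta> * t 0)"
proof -
  define E where "E n = exp (- \<beta> * (\<Sum>j\<le>n. t j))" for n
  have f0: "0 \<le> f k" for k
    using r0 by (simp add: f_def)
  have step: "f (Suc n) \<le> w * (E n - E (Suc n))" for n
  proof -
    have "f (Suc n) \<le> w * (exp (\<beta> * t (Suc n)) - 1) * E (Suc n)"
      unfolding f_def E_def by (intro mult_right_mono r) simp
    also have "\<dots> = w * (exp (\<beta> * t (Suc n)) * E (Suc n) - E (Suc n))"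
      by (simp add: algebra_simps)
    also have "exp (\<beta> * t (Suc n)) * E (Suc n) = E n"
      by (simp add: E_def algebra_simps flip: exp_add)
    finally show ?thesis .
  qed
  \<comment> \<open>The summand \<open>- w * E n\<close> reserves the value \<open>w\<close>,
    discounted through round \<open>n\<close>, for the later rounds; it pays for the next
    term.\<close>
  have telescope: "sum f {..<Suc n} \<le> (r 0 + w) * exp (- \<beta> * t 0) - w * E n" for n
  proof (induction n)
    case 0
    show ?case by (simp add: f_def E_def algebra_simps)
  next
    case (Suc n)
    then show ?case using step[of n] by (simp add: algebra_simps)
  qed
  have bound: "sum f {..<n} \<le> (r 0 + w) * exp (- \<beta> * t 0)" for n
  proof -
    have "sum f {..<n} \<le> sum f {..<Suc n}" using f0[of n] by simp
    also note telescope[of n]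
    also have "(r 0 + w) * exp (- \<beta> * t 0) - w * E n \<le> (r 0 + w) * exp (- \<beta> * t 0)"
      using w by (simp add: E_def)
    finally show ?thesis .
  qed
  have sf: "summable f"
    using f0 bound by (intro summableI_nonneg_bounded)
  show "suminf f \<le> (r 0 + w) * exp (- \<beta> * t 0)"
    using bound by (intro suminf_le_const[OF sf])
qed

section \<open>Expected utility under independently drawn actions\<close>

lemma AE_strategy_mem:
  fixes \<sigma> :: "nat \<Rightarrow> 'a pmf"
  assumes "\<And>k. set_pmf (\<sigma> k) \<subseteq> S"
  shows "AE a in \<Pi>\<^sub>M k\<in>UNIV. measure_pmf (\<sigma> k). \<forall>k. a k \<in> S"
proof -
  interpret product_prob_space "\<lambda>k. measure_pmf (\<sigma> k)" UNIV
    by unfold_locales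
  show ?thesis
    unfolding AE_all_countable
  proof (intro allI)
    fix k
    have "AE i in measure_pmf (\<sigma> k). i \<in> S"
      using assms by (auto simp: AE_measure_pmf_iff)
    then show "AE a in \<Pi>\<^sub>M k\<in>UNIV. measure_pmf (\<sigma> k). a k \<in> S"
      by (intro AE_component) auto
  qed
qed

text \<open>The pathwise bound depends on the first action only, and the marginal of the product
  measure at round 0 is \<open>\<sigma> 0\<close>. The right-hand integrand is the first reward plus
  a continuation value \<open>w\<close>, both discounted by the first sojourn time.\<close>

lemma total_utility_le_expectation:
  fixes w \<beta> :: real
  assumes util: "util G = exp_discounting \<beta>" and \<sigma>: "\<sigma> \<in> strategies G" and w: "0 \<le> w"
    and r0: "\<And>i. i \<in> actions G \<Longrightarrow> 0 \<le> reward G i"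
    and r: "\<And>i. i \<in> actions G \<Longrightarrow> reward G i \<le> w * (exp (\<beta> * t i) - 1)"
  shows "total_utility G \<sigma> t
    \<le> measure_pmf.expectation (\<sigma> 0) (\<lambda>i. (reward G i + w) * exp (- \<beta> * t i))"
proof -
  interpret product_prob_space "\<lambda>k. measure_pmf (\<sigma> k)" UNIV
    by unfold_locales
  let ?P = "\<Pi>\<^sub>M k\<in>UNIV. measure_pmf (\<sigma> k)"
  let ?g = "\<lambda>i. (reward G i + w) * exp (- \<beta> * t i)"
  have supp: "set_pmf (\<sigma> k) \<subseteq> actions G" for k
    using \<sigma> by (auto simp: strategies_def mixed_actions_def)
  have component: "distr ?P (measure_pmf (\<sigma> 0)) (\<lambda>a. a 0) = measure_pmf (\<sigma> 0)"
    by (rule PiM_component) simp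
  have "finite (set_pmf (\<sigma> 0))"
    using supp[of 0] by (rule finite_subset) (simp add: actions_def)
  then have "integrable (measure_pmf (\<sigma> 0)) ?g"
    by (rule integrable_measure_pmf_finite)
  then have "integrable (distr ?P (measure_pmf (\<sigma> 0)) (\<lambda>a. a 0)) ?g"
    by (simp only: component)
  then have int: "integrable ?P (\<lambda>a. ?g (a 0))"
    by (rule integrable_distr[rotated]) simp
  have "total_utility G \<sigma> t \<le> (\<integral>a. ?g (a 0) \<partial>?P)"
    unfolding total_utility_def util exp_discounting_def
  \<comment> \<open>This comparison asks for integrability of the bound alone: a nonintegrable
    utility would have integral 0, which the nonnegativity of the bound covers.\<close>
  proof (rule integral_mono_AE')
    show "AE a in ?P. (\<Sum>k. reward G (a k) * exp (- \<beta> * (\<Sum>j\<le>k. t (a j)))) \<le> ?g (a 0)"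
      using AE_strategy_mem[OF supp]
    proof eventually_elim
      case (elim a)
      then show ?case
        using w r0 r by (intro discounted_sum_le[where r = "\<lambda>k. reward G (a k)"
          and t = "\<lambda>k. t (a k)"]) auto
    qed
    show "AE a in ?P. 0 \<le> ?g (a 0)"
      using AE_strategy_mem[OF supp] by eventually_elim (use w r0 in auto)
  qed (rule int)
  also have "\<dots> = (\<integral>i. ?g i \<partial>distr ?P (measure_pmf (\<sigma> 0)) (\<lambda>a. a 0))"
    by (rule integral_distr[symmetric]) simp_all
  also have "\<dots> = measure_pmf.expectation (\<sigma> 0) ?g"
    by (simp only: component)
  finally show ?thesis .
qed

text \<open>The hypothesis amounts to \<open>r + w \<le> w * exp x\<close>. This is the one-step
  optimality inequality: playing an action once and then continuing with value \<open>w\<close> is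
  worth at most \<open>w\<close>.\<close>

lemma continuation_le:
  fixes r w x :: real
  assumes "r \<le> w * (exp x - 1)"
  shows "(r + w) * exp (- x) \<le> w"
proof -
  have "(r + w) * exp (- x) \<le> w * exp x * exp (- x)"
    using assms by (intro mult_right_mono) (auto simp: algebra_simps)
  also have "\<dots> = w" by (simp add: mult.assoc flip: exp_add)
  finally show ?thesis .
qed

lemma total_utility_le:
  fixes w \<beta> :: real
  assumes "util G = exp_discounting \<beta>" and \<sigma>: "\<sigma> \<in> strategies G" and "0 \<le> w"
    and "\<And>i. i \<in> actions G \<Longrightarrow> 0 \<le> reward G i"
    and r: "\<And>i. i \<in> actions G \<Longrightarrow> reward G i \<le> w * (exp (\<beta> * t i) - 1)"
  shows "total_utility G \<sigma> t \<le> w"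
proof -
  let ?g = "\<lambda>i. (reward G i + w) * exp (- \<beta> * t i)"
  have supp: "set_pmf (\<sigma> 0) \<subseteq> actions G"
    using \<sigma> by (auto simp: strategies_def mixed_actions_def)
  then have "finite (set_pmf (\<sigma> 0))"
    by (rule finite_subset) (simp add: actions_def)
  then have int: "integrable (measure_pmf (\<sigma> 0)) ?g"
    by (rule integrable_measure_pmf_finite)
  have "AE i in measure_pmf (\<sigma> 0). ?g i \<le> w"
    using supp continuation_le[OF r] by (auto simp: AE_measure_pmf_iff)
  with int have "measure_pmf.expectation (\<sigma> 0) ?g \<le> w"
    by (rule measure_pmf.integral_le_const)
  with total_utility_le_expectation[OF assms] show ?thesis by linarith
qed

text \<open>A geometric series of ratio \<open>exp (- (\<beta> * t i))\<close>. Taken at a best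
  action, it matches the bound of \<open>total_utility_le\<close>.\<close>

lemma total_utility_pure:
  fixes \<beta> :: real
  assumes util: "util G = exp_discounting \<beta>" and t: "0 < \<beta> * t i"
  shows "total_utility G (\<lambda>_. return_pmf i) t = reward G i / (exp (\<beta> * t i) - 1)"
proof -
  interpret product_prob_space "\<lambda>_::nat. measure_pmf (return_pmf i)" UNIV
    by unfold_locales
  let ?P = "\<Pi>\<^sub>M k\<in>(UNIV::nat set). measure_pmf (return_pmf i)"
  let ?q = "exp (- (\<beta> * t i))"
  have q: "0 < ?q" "?q < 1" using t by auto
  have val: "(\<Sum>k. reward G i * exp (- \<beta> * (\<Sum>j\<le>k. t i))) = reward G i / (exp (\<beta> * t i) - 1)"
  proof -
    have "(\<lambda>k. reward G i * exp (- \<beta> * (\<Sum>j\<le>k. t i))) = (\<lambda>k. (reward G i * ?q) * ?q ^ k)"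
      by (auto simp: algebra_simps exp_add exp_of_nat_mult[symmetric] fun_eq_iff
          simp flip: exp_add)
    moreover have "(\<lambda>k. (reward G i * ?q) * ?q ^ k) sums ((reward G i * ?q) * (1 / (1 - ?q)))"
      using q by (intro sums_mult geometric_sums) simp
    moreover have "(reward G i * ?q) * (1 / (1 - ?q)) = reward G i / (exp (\<beta> * t i) - 1)"
      using t by (simp add: exp_minus field_simps)
    ultimately show ?thesis by (metis sums_unique)
  qed
  have coord: "(\<lambda>a. h (a k)) \<in> borel_measurable ?P" for h :: "nat \<Rightarrow> real" and k :: nat
    by (rule measurable_compose[OF measurable_component_singleton[of k UNIV]]) simp_all
  have "total_utility G (\<lambda>_. return_pmf i) t
      = (\<integral>a. reward G i / (exp (\<beta> * t i) - 1) \<partial>?P)"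
    unfolding total_utility_def util exp_discounting_def
  proof (rule integral_cong_AE)
    show "(\<lambda>a. \<Sum>k. reward G (a k) * exp (- \<beta> * (\<Sum>j\<le>k. t (a j)))) \<in> borel_measurable ?P"
      by (intro borel_measurable_suminf borel_measurable_times coord
          measurable_compose[OF _ borel_measurable_exp] borel_measurable_sum borel_measurable_const)
    have "AE a in ?P. \<forall>k. a k \<in> {i}"
      by (rule AE_strategy_mem) simp
    then show "AE a in ?P. (\<Sum>k. reward G (a k) * exp (- \<beta> * (\<Sum>j\<le>k. t (a j))))
        = reward G i / (exp (\<beta> * t i) - 1)"
      by eventually_elim (simp only: singleton_iff val)
  qed simp
  then show ?thesis by (simp add: P.prob_space)
qed

section \<open>The upper bound\<close>

text \<open>\<open>w\<close> is the best value of a pure stationary action. Deviating to it shows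
  that the equilibrium is worth at least \<open>w\<close>, while the first-step bound is an average
  over \<open>p\<close> of terms that are at most \<open>w\<close>. Hence these terms equal
  \<open>w\<close> wherever \<open>p\<close> is positive, which gives the equality for actions
  carrying mass.\<close>

lemma equilibrium_value:
  fixes \<beta> :: real
  assumes valid: "valid_game G" and \<beta>: "\<beta> > 0" and util: "util G = exp_discounting \<beta>"
    and eq: "\<mu> \<in> stationary_equilibria G"
  obtains w where "w > 0"
    and "\<And>i. i \<in> actions G \<Longrightarrow> reward G i \<le> w * (exp (\<beta> * sojourn G i \<mu>) - 1)"
    and "\<And>i. i \<in> actions G \<Longrightarrow> \<mu> i \<noteq> 0 \<Longrightarrow> reward G i = w * (exp (\<beta> * sojourn G i \<mu>) - 1)"
proof -
  define t where "t = (\<lambda>i. sojourn G i \<mu>)"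
  define v where "v i = reward G i / (exp (\<beta> * t i) - 1)" for i
  define w where "w = Max (v ` actions G)"
  have \<mu>: "\<mu> \<in> mass_dists G (mass G)" using eq by (simp add: stationary_equilibria_def)
  then have "\<mu> \<in> all_mass_dists G"
    using valid by (auto simp: all_mass_dists_def valid_game_def)
  then have t0: "\<And>i. i \<in> actions G \<Longrightarrow> t i > 0" and r0: "\<And>i. i \<in> actions G \<Longrightarrow> reward G i > 0"
    using valid by (auto simp: valid_game_def t_def)
  have E: "exp (\<beta> * t i) - 1 > 0" if "i \<in> actions G" for i
    using t0[OF that] \<beta> by simp
  have fin: "finite (actions G)" and ne: "actions G \<noteq> {}"
    using valid by (auto simp: actions_def valid_game_def)
  have vw: "v i \<le> w" if "i \<in> actions G" for i
    using that fin by (simp add: w_def)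
  have rw: "reward G i \<le> w * (exp (\<beta> * t i) - 1)" if "i \<in> actions G" for i
    using vw[OF that] E[OF that] by (simp add: v_def field_simps)
  have "w \<in> v ` actions G" unfolding w_def using fin ne by (intro Max_in) auto
  then obtain b where b: "b \<in> actions G" "w = v b" by auto
  have w0: "w > 0" using r0[OF b(1)] E[OF b(1)] b(2) by (simp add: v_def)
  obtain p \<theta> where p: "p \<in> mixed_actions G"
    and \<theta>: "\<And>i. i \<in> actions G \<Longrightarrow> \<mu> i = \<theta> * pmf p i * t i"
    and opt: "ereal (total_utility G (\<lambda>_. p) t)
      = (SUP \<sigma>\<in>strategies G. ereal (total_utility G \<sigma> t))"
    using eq unfolding stationary_equilibria_def t_def by auto
  let ?g = "\<lambda>i. (reward G i + w) * exp (- \<beta> * t i)"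
  have g: "?g i \<le> w" if "i \<in> actions G" for i
    using continuation_le[OF rw[OF that]] by simp
  have "w = total_utility G (\<lambda>_. return_pmf b) t"
    using total_utility_pure[OF util, of t b] \<beta> t0[OF b(1)] b(2) by (simp add: v_def)
  also have "ereal \<dots> \<le> ereal (total_utility G (\<lambda>_. p) t)"
    unfolding opt using b(1) by (intro SUP_upper) (auto simp: strategies_def mixed_actions_def)
  finally have "w \<le> total_utility G (\<lambda>_. p) t" by simp
  also have "\<dots> \<le> measure_pmf.expectation p ?g"
    using p w0 r0 rw by (intro total_utility_le_expectation[OF util])
      (auto simp: strategies_def less_imp_le)
  also have "\<dots> = (\<Sum>i\<in>actions G. ?g i * pmf p i)"
    using fin p by (subst integral_measure_pmf_real[of "actions G"])
      (auto simp: mixed_actions_def)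
  finally have "w \<le> (\<Sum>i\<in>actions G. ?g i * pmf p i)" .
  moreover have "(\<Sum>i\<in>actions G. pmf p i) = 1"
    using fin p by (intro sum_pmf_eq_1) (auto simp: mixed_actions_def)
  ultimately have "(\<Sum>i\<in>actions G. (w - ?g i) * pmf p i) \<le> 0"
    by (simp add: left_diff_distrib sum_subtractf flip: sum_distrib_left)
  moreover have "0 \<le> (w - ?g i) * pmf p i" if "i \<in> actions G" for i
    using g[OF that] by simp
  ultimately have zero: "(w - ?g i) * pmf p i = 0" if "i \<in> actions G" for i
    using that fin sum_nonneg_eq_0_iff[of "actions G" "\<lambda>i. (w - ?g i) * pmf p i"]
    by (meson order_antisym sum_nonneg)
  have "reward G i = w * (exp (\<beta> * t i) - 1)" if i: "i \<in> actions G" and "\<mu> i \<noteq> 0" for i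
  proof -
    \<comment> \<open>By the normalization equation \<open>\<theta>\<close>, an action carrying mass
      has \<open>pmf p i \<noteq> 0\<close>, so the other factor in \<open>zero\<close>
      vanishes.\<close>
    have "?g i = w" using zero[OF i] \<theta>[OF i] \<open>\<mu> i \<noteq> 0\<close> by auto
    then show ?thesis by (simp add: exp_minus field_simps)
  qed
  with w0 rw show thesis by (intro that[of w]) (auto simp: t_def)
qed

lemma sojourn_le_char_number:
  assumes "valid_game G" and "char_number \<beta> G = ereal M" and i: "i \<in> actions G"
    and \<mu>: "\<mu> \<in> mass_dists G (mass G)"
  shows "(exp (\<beta> * sojourn G i \<mu>) - 1) / (\<beta> * sojourn G i \<mu>) \<le> M"
proof -
  have "ereal ((exp (\<beta> * sojourn G i \<mu>) - 1) / (\<beta> * sojourn G i \<mu>)) \<le> char_number_action \<beta> G i"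
    unfolding char_number_action_def using \<mu> by (rule SUP_upper)
  also have "\<dots> \<le> char_number \<beta> G"
    unfolding char_number_def using i by (intro Max_ge) (auto simp: actions_def)
  finally show ?thesis using assms(2) by simp
qed

section \<open>Comparison of an optimum with an equilibrium\<close>

lemma price_of_anarchy_le:
  fixes M \<beta> :: real
  assumes valid: "valid_game G" and \<beta>: "\<beta> > 0" and util: "util G = exp_discounting \<beta>"
    and mono: "rate_monotonous G" and char: "char_number \<beta> G = ereal M"
    and opt: "\<mu>opt \<in> social_optima G" and eq: "\<mu>eq \<in> stationary_equilibria G"
  shows "social_welfare G \<mu>opt / social_welfare G \<mu>eq \<le> M + 1"
proof -
  obtain w where w: "w > 0"
    and w_ge: "\<And>i. i \<in> actions G \<Longrightarrow> reward G i \<le> w * (exp (\<beta> * sojourn G i \<mu>eq) - 1)"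
    and w_eq: "\<And>i. i \<in> actions G \<Longrightarrow> \<mu>eq i \<noteq> 0
      \<Longrightarrow> reward G i = w * (exp (\<beta> * sojourn G i \<mu>eq) - 1)"
    using equilibrium_value[OF valid \<beta> util eq] by blast
  have eqm: "\<mu>eq \<in> mass_dists G (mass G)" using eq by (simp add: stationary_equilibria_def)
  obtain s where s: "0 < s" "s \<le> mass G" and om: "\<mu>opt \<in> mass_dists G s"
    using opt by (auto simp: social_optima_def is_arg_max_def)
  have all: "\<mu>eq \<in> all_mass_dists G" "\<mu>opt \<in> all_mass_dists G"
    using eqm om s valid by (auto simp: all_mass_dists_def valid_game_def)
  have pos: "\<And>i. i \<in> actions G \<Longrightarrow> sojourn G i \<mu>eq > 0"
    "\<And>i. i \<in> actions G \<Longrightarrow> sojourn G i \<mu>opt > 0"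
    "\<And>i. i \<in> actions G \<Longrightarrow> reward G i > 0" and m0: "mass G > 0"
    using valid all by (auto simp: valid_game_def)
  have nn: "\<And>i. i \<in> actions G \<Longrightarrow> \<mu>eq i \<ge> 0" "\<And>i. i \<in> actions G \<Longrightarrow> \<mu>opt i \<ge> 0"
    and sums: "sum \<mu>eq (actions G) = mass G" "sum \<mu>opt (actions G) = s"
    using eqm om by (auto simp: mass_dists_def)
  have charle: "exp (\<beta> * sojourn G i \<mu>eq) - 1 \<le> M * (\<beta> * sojourn G i \<mu>eq)"
    if "i \<in> actions G" for i
    using sojourn_le_char_number[OF valid char that eqm] pos(1)[OF that] \<beta>
    by (simp add: pos_divide_le_eq)
  have M0: "M \<ge> 0"
  proof -
    obtain i where i: "i \<in> actions G"
      using valid by (force simp: actions_def valid_game_def)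
    have "0 < M * (\<beta> * sojourn G i \<mu>eq)"
      using charle[OF i] pos(1)[OF i] \<beta> by (smt (verit) exp_gt_one mult_pos_pos)
    moreover have "0 < \<beta> * sojourn G i \<mu>eq" using pos(1)[OF i] \<beta> by simp
    ultimately have "0 < M" by (rule zero_less_mult_pos2)
    then show ?thesis by simp
  qed
  \<comment> \<open>Where there is mass, \<open>w_eq\<close> and \<open>exp x - 1 \<ge> x\<close>
    bound the reward below by \<open>w * \<beta>\<close> times the sojourn time, so each unit of
    mass earns at least \<open>w * \<beta>\<close>.\<close>
  have eqSW: "w * \<beta> * mass G \<le> social_welfare G \<mu>eq"
  proof -
    have "w * \<beta> * \<mu>eq i \<le> reward G i * action_rate G i \<mu>eq" if i: "i \<in> actions G" for i
    proof (cases "\<mu>eq i = 0")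
      case False
      have "w * (\<beta> * sojourn G i \<mu>eq) \<le> reward G i"
        unfolding w_eq[OF i False] using w exp_ge_add_one_self[of "\<beta> * sojourn G i \<mu>eq"]
        by (intro mult_left_mono) linarith+
      then have "w * (\<beta> * sojourn G i \<mu>eq) * \<mu>eq i \<le> reward G i * \<mu>eq i"
        using nn(1)[OF i] by (intro mult_right_mono)
      then show ?thesis using pos(1)[OF i] by (simp add: action_rate_def field_simps)
    qed (simp add: action_rate_def)
    then have "(\<Sum>i\<in>actions G. w * \<beta> * \<mu>eq i) \<le> social_welfare G \<mu>eq"
      unfolding social_welfare_def by (rule sum_mono)
    then show ?thesis by (simp add: sums flip: sum_distrib_left)
  qed
  have "reward G i * action_rate G i \<mu>opt
      \<le> reward G i * action_rate G i \<mu>eq + M * (w * \<beta>) * \<mu>opt i" if i: "i \<in> actions G" for i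
  proof (cases "action_rate G i \<mu>eq < action_rate G i \<mu>opt")
    case True
    then have le: "sojourn G i \<mu>eq \<le> sojourn G i \<mu>opt"
      using mono all i by (auto simp: rate_monotonous_def)
    have "reward G i \<le> w * (M * (\<beta> * sojourn G i \<mu>eq))"
      using w_ge[OF i] charle[OF i] w by (smt (verit) mult_left_mono)
    also have "\<dots> \<le> w * (M * (\<beta> * sojourn G i \<mu>opt))"
      using w M0 \<beta> le by (intro mult_left_mono) auto
    finally have "reward G i * \<mu>opt i \<le> w * (M * (\<beta> * sojourn G i \<mu>opt)) * \<mu>opt i"
      using nn(2)[OF i] by (intro mult_right_mono)
    then have "reward G i * action_rate G i \<mu>opt \<le> M * (w * \<beta>) * \<mu>opt i"
      using pos(2)[OF i] by (simp add: action_rate_def field_simps)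
    moreover have "0 \<le> reward G i * action_rate G i \<mu>eq"
      using pos[OF i] nn(1)[OF i] by (simp add: action_rate_def)
    ultimately show ?thesis by linarith
  next
    case False
    then have "reward G i * action_rate G i \<mu>opt \<le> reward G i * action_rate G i \<mu>eq"
      using pos(3)[OF i] by (intro mult_left_mono) auto
    moreover have "0 \<le> M * (w * \<beta>) * \<mu>opt i"
      using M0 w \<beta> nn(2)[OF i] by simp
    ultimately show ?thesis by linarith
  qed
  then have "social_welfare G \<mu>opt
      \<le> (\<Sum>i\<in>actions G. reward G i * action_rate G i \<mu>eq + M * (w * \<beta>) * \<mu>opt i)"
    unfolding social_welfare_def by (rule sum_mono)
  also have "\<dots> = social_welfare G \<mu>eq + M * (w * \<beta>) * s"
    by (simp add: social_welfare_def sum.distrib sums flip: sum_distrib_left)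
  also have "M * (w * \<beta>) * s \<le> M * (w * \<beta>) * mass G"
    using s M0 w \<beta> by (intro mult_left_mono) auto
  also have "M * (w * \<beta>) * mass G = M * (w * \<beta> * mass G)" by simp
  also have "\<dots> \<le> M * social_welfare G \<mu>eq"
    using eqSW M0 by (rule mult_left_mono)
  finally have "social_welfare G \<mu>opt \<le> (M + 1) * social_welfare G \<mu>eq"
    by (simp add: algebra_simps)
  moreover have "social_welfare G \<mu>eq > 0"
    using eqSW w \<beta> m0 by (smt (verit) mult_pos_pos)
  ultimately show ?thesis by (simp add: pos_divide_le_eq)
qed

section \<open>Tightness\<close>

declare One_nat_def [simp del]

text \<open>Action 1 is a queue: its rate \<open>min (\<mu>\<^sub>1 / \<epsilon>\<^sup>2) (1 / \<epsilon>)\<close> is already saturated at mass \<open>\<epsilon>\<close>.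
  The rewards make both actions worth 1 when all the mass queues for action 1.\<close>

definition queue_game :: "real \<Rightarrow> real \<Rightarrow> game" where
  "queue_game \<epsilon> T = \<lparr>mass = 1, num_actions = 2,
     reward = (\<lambda>i. if i = 1 then exp \<epsilon> - 1 else exp T - 1),
     sojourn = (\<lambda>i \<mu>. if i = 1 then max (\<epsilon>\<^sup>2) (\<epsilon> * \<mu> 1) else T),
     util = exp_discounting 1\<rparr>"

lemma queue_game_sel [simp]:
  "mass (queue_game \<epsilon> T) = 1"
  "reward (queue_game \<epsilon> T) i = (if i = 1 then exp \<epsilon> - 1 else exp T - 1)"
  "sojourn (queue_game \<epsilon> T) i = (if i = 1 then (\<lambda>\<mu>. max (\<epsilon>\<^sup>2) (\<epsilon> * \<mu> 1)) else (\<lambda>\<mu>. T))"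
  "util (queue_game \<epsilon> T) = exp_discounting 1"
  by (auto simp: queue_game_def)

lemma actions_queue_game [simp]: "actions (queue_game \<epsilon> T) = {1, 2}"
  by (auto simp: actions_def queue_game_def)

definition two_masses :: "real \<Rightarrow> real \<Rightarrow> nat \<Rightarrow> real" where
  "two_masses x y i = (if i = 1 then x else if i = 2 then y else 0)"

lemma two_masses_in [simp]:
  "two_masses x y \<in> mass_dists (queue_game \<epsilon> T) s \<longleftrightarrow> 0 \<le> x \<and> 0 \<le> y \<and> x + y = s"
  by (auto simp: two_masses_def mass_dists_def)

text \<open>\<open>T\<close> gives the constant action characteristic number \<open>M\<close>;
  \<open>\<epsilon> \<le> M - 1\<close> keeps that of the queue below it, and
  \<open>\<epsilon> \<le> 1 / M\<close> makes it optimal to saturate the queue first.\<close>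

context
  fixes \<epsilon> T M :: real
  assumes \<epsilon>: "0 < \<epsilon>" "\<epsilon> \<le> 1" "\<epsilon> \<le> M - 1" "\<epsilon> \<le> 1 / M"
    and T: "0 < T" "exp T - 1 = M * T"
begin

lemma M_pos: "0 < M" using \<epsilon> by linarith

section \<open>The queue game belongs to the class\<close>

lemma queue_valid: "valid_game (queue_game \<epsilon> T)"
  using \<epsilon> T by (auto simp: valid_game_def less_max_iff_disj) (simp add: queue_game_def)

lemma queue_continuous: "continuous_sojourn (queue_game \<epsilon> T)"
  by (auto simp: continuous_sojourn_def intro!: continuous_intros continuous_on_product_coordinates
    intro: continuous_on_subset)

lemma queue_rate:
  "action_rate (queue_game \<epsilon> T) 1 \<mu> = min (\<mu> 1 / \<epsilon>\<^sup>2) (1 / \<epsilon>)" if "0 \<le> \<mu> 1"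
  using \<epsilon> that by (auto simp: action_rate_def max_def min_def field_simps power2_eq_square)

text \<open>Rate and sojourn time of the queue are both nondecreasing in its own mass, so a strictly
  larger rate forces a larger mass. The other sojourn time is constant.\<close>

lemma queue_rate_monotonous: "rate_monotonous (queue_game \<epsilon> T)"
proof -
  have "max (\<epsilon>\<^sup>2) (\<epsilon> * \<mu> 1) \<le> max (\<epsilon>\<^sup>2) (\<epsilon> * \<mu>' 1)"
    if "\<mu> 1 \<ge> 0" "\<mu>' 1 \<ge> 0"
      "action_rate (queue_game \<epsilon> T) 1 \<mu> < action_rate (queue_game \<epsilon> T) 1 \<mu>'"
    for \<mu> \<mu>' :: "nat \<Rightarrow> real"
  proof -
    have "\<mu> 1 / \<epsilon>\<^sup>2 < \<mu>' 1 / \<epsilon>\<^sup>2"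
      using that(3) unfolding queue_rate[of \<mu>, OF that(1)] queue_rate[of \<mu>', OF that(2)]
      by (auto simp: min_def split: if_splits)
    then have "\<epsilon> * \<mu> 1 \<le> \<epsilon> * \<mu>' 1"
      using \<epsilon> by (simp add: divide_less_cancel)
    then show ?thesis by (auto simp: le_max_iff_disj)
  qed
  then show ?thesis
    by (auto simp: rate_monotonous_def all_mass_dists_def mass_dists_def)
qed

text \<open>The constant action contributes exactly \<open>(exp T - 1) / T = M\<close>. The sojourn
  time \<open>t\<close> of the queue lies between 0 and \<open>\<epsilon>\<close>, where
  \<open>(exp t - 1) / t \<le> 1 + t \<le> M\<close>.\<close>

lemma queue_char_number: "char_number 1 (queue_game \<epsilon> T) = ereal M"
proof -
  let ?U = "mass_dists (queue_game \<epsilon> T) 1"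
  have ne: "?U \<noteq> {}"
    using two_masses_in[of 1 0 \<epsilon> T 1] by force
  have "char_number_action 1 (queue_game \<epsilon> T) 2 = (SUP \<mu>\<in>?U. ereal M)"
    using T by (simp add: char_number_action_def)
  also have "\<dots> = ereal M" using ne by simp
  finally have c2: "char_number_action 1 (queue_game \<epsilon> T) 2 = ereal M" .
  have "char_number_action 1 (queue_game \<epsilon> T) 1 \<le> ereal M"
    unfolding char_number_action_def
  proof (rule SUP_least)
    fix \<mu> assume "\<mu> \<in> mass_dists (queue_game \<epsilon> T) (mass (queue_game \<epsilon> T))"
    then have "\<mu> 1 \<le> 1" by (auto simp: mass_dists_def)
    then have "\<epsilon> * \<mu> 1 \<le> \<epsilon>" using \<epsilon> by (intro mult_left_le) auto
    moreover have "\<epsilon>\<^sup>2 \<le> \<epsilon>" using \<epsilon> by (simp add: power2_eq_square)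
    ultimately have "max (\<epsilon>\<^sup>2) (\<epsilon> * \<mu> 1) \<le> \<epsilon>" by simp
    moreover have "0 < max (\<epsilon>\<^sup>2) (\<epsilon> * \<mu> 1)"
      using \<epsilon> by (simp add: less_max_iff_disj)
    ultimately obtain t where t: "t = max (\<epsilon>\<^sup>2) (\<epsilon> * \<mu> 1)" "0 < t" "t \<le> \<epsilon>"
      by blast
    have "exp t \<le> 1 + t + t\<^sup>2"
      using t(2,3) \<epsilon> by (intro exp_bound) auto
    also have "t\<^sup>2 \<le> (M - 1) * t"
      using t(2,3) \<epsilon> by (simp add: power2_eq_square)
    finally have "(exp t - 1) / t \<le> M"
      using t(2) by (simp add: field_simps)
    then show "ereal ((exp (1 * sojourn (queue_game \<epsilon> T) 1 \<mu>) - 1)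
        / (1 * sojourn (queue_game \<epsilon> T) 1 \<mu>)) \<le> ereal M"
      using t by simp
  qed
  then show ?thesis
    by (simp add: char_number_def c2 max_def)
qed

text \<open>With all mass queued the queue takes time \<open>\<epsilon>\<close>, and the rewards
  make both actions worth 1. So \<open>total_utility_le\<close> with \<open>w = 1\<close> bounds
  every strategy, and queueing forever attains the bound.\<close>

lemma queue_equilibrium: "two_masses 1 0 \<in> stationary_equilibria (queue_game \<epsilon> T)"
proof -
  let ?G = "queue_game \<epsilon> T"
  let ?\<mu> = "two_masses 1 0"
  define t where "t = (\<lambda>i. sojourn ?G i ?\<mu>)"
  have t: "t = (\<lambda>i. if i = 1 then \<epsilon> else T)"
    using \<epsilon> by (auto simp: t_def two_masses_def max_def power2_eq_square)
  have soj: "sojourn ?G i ?\<mu> = t i" for i by (simp only: t_def)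
  have p: "return_pmf 1 \<in> mixed_actions ?G"
    by (simp add: mixed_actions_def)
  have u1: "total_utility ?G (\<lambda>_. return_pmf 1) t = 1"
    using \<epsilon> by (subst total_utility_pure[where \<beta> = 1]) (auto simp: t)
  have "total_utility ?G \<sigma> t \<le> 1" if "\<sigma> \<in> strategies ?G" for \<sigma>
    using \<epsilon> T that by (intro total_utility_le[where \<beta> = 1]) (auto simp: t)
  then have "(SUP \<sigma>\<in>strategies ?G. ereal (total_utility ?G \<sigma> t)) = 1"
    using p u1 by (intro antisym SUP_least SUP_upper2[of "\<lambda>_. return_pmf 1"])
      (auto simp: strategies_def one_ereal_def)
  moreover have "\<forall>i\<in>actions ?G. ?\<mu> i = (1 / \<epsilon>) * pmf (return_pmf 1) i * t i"
    using \<epsilon> by (auto simp: t two_masses_def)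
  moreover have "?\<mu> \<in> mass_dists ?G (mass ?G)" by simp
  ultimately show ?thesis
    using p u1 unfolding stationary_equilibria_def mem_Collect_eq soj
    by (intro conjI bexI[of _ "return_pmf 1"] exI[of _ "1 / \<epsilon>"]) (simp_all add: one_ereal_def del: queue_game_sel(3))
qed

lemma queue_welfare:
  "social_welfare (queue_game \<epsilon> T) \<mu> = (exp \<epsilon> - 1) * min (\<mu> 1 / \<epsilon>\<^sup>2) (1 / \<epsilon>) + M * \<mu> 2"
  if "0 \<le> \<mu> 1"
  using that T by (simp add: social_welfare_def queue_rate) (simp add: action_rate_def)

text \<open>With mass \<open>x\<close> on the queue and the rest on the other action, welfare is
  concave and piecewise linear in \<open>x\<close>, with its kink at \<open>\<epsilon>\<close>. The
  slope is \<open>(exp \<epsilon> - 1) / \<epsilon>\<^sup>2 - M \<ge> 0\<close> before the kink and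
  \<open>- M\<close> after it.\<close>

lemma queue_optimum: "two_masses \<epsilon> (1 - \<epsilon>) \<in> social_optima (queue_game \<epsilon> T)"
proof -
  let ?G = "queue_game \<epsilon> T"
  let ?o = "two_masses \<epsilon> (1 - \<epsilon>)"
  have o: "social_welfare ?G ?o = (exp \<epsilon> - 1) * (1 / \<epsilon>) + M * (1 - \<epsilon>)"
    using \<epsilon> by (subst queue_welfare) (auto simp: two_masses_def power2_eq_square)
  have "social_welfare ?G \<nu> \<le> social_welfare ?G ?o" if "\<nu> \<in> mass_dists ?G s" "s \<le> 1" for \<nu> s
  proof -
    have \<nu>: "0 \<le> \<nu> 1" "0 \<le> \<nu> 2" "\<nu> 1 + \<nu> 2 \<le> 1"
      using that by (auto simp: mass_dists_def)
    then have "M * \<nu> 2 \<le> M * (1 - \<nu> 1)" using M_pos by (intro mult_left_mono) auto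
    \<comment> \<open>The line of slope \<open>M\<close> through the kink supports the concave
      welfare of the queue from above.\<close>
    moreover have "(exp \<epsilon> - 1) * min (\<nu> 1 / \<epsilon>\<^sup>2) (1 / \<epsilon>) \<le> (exp \<epsilon> - 1) * (1 / \<epsilon>) + M * (\<nu> 1 - \<epsilon>)"
    proof (cases "\<nu> 1 \<le> \<epsilon>")
      case True
      have "M \<le> 1 / \<epsilon>" using \<epsilon> M_pos by (simp add: field_simps)
      also have "\<dots> \<le> (exp \<epsilon> - 1) / \<epsilon>\<^sup>2"
        using \<epsilon> exp_ge_add_one_self[of \<epsilon>]
        by (simp add: power2_eq_square field_simps)
      finally have "M * (\<epsilon> - \<nu> 1) \<le> (exp \<epsilon> - 1) / \<epsilon>\<^sup>2 * (\<epsilon> - \<nu> 1)"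
        using True by (intro mult_right_mono) auto
      also have "\<dots> = (exp \<epsilon> - 1) * (1 / \<epsilon>) - (exp \<epsilon> - 1) * (\<nu> 1 / \<epsilon>\<^sup>2)"
        using \<epsilon> by (simp add: field_simps power2_eq_square)
      finally have "(exp \<epsilon> - 1) * (\<nu> 1 / \<epsilon>\<^sup>2) \<le> (exp \<epsilon> - 1) * (1 / \<epsilon>) + M * (\<nu> 1 - \<epsilon>)"
        by (simp add: right_diff_distrib)
      moreover have "(exp \<epsilon> - 1) * min (\<nu> 1 / \<epsilon>\<^sup>2) (1 / \<epsilon>) \<le> (exp \<epsilon> - 1) * (\<nu> 1 / \<epsilon>\<^sup>2)"
        using \<epsilon> by (intro mult_left_mono) auto
      ultimately show ?thesis by linarith
    next
      case False
      have "(exp \<epsilon> - 1) * min (\<nu> 1 / \<epsilon>\<^sup>2) (1 / \<epsilon>) \<le> (exp \<epsilon> - 1) * (1 / \<epsilon>)"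
        using \<epsilon> by (intro mult_left_mono) auto
      moreover have "0 \<le> M * (\<nu> 1 - \<epsilon>)" using False M_pos by simp
      ultimately show ?thesis by linarith
    qed
    ultimately show ?thesis
      unfolding o queue_welfare[where \<mu> = \<nu>, OF \<nu>(1)] by (simp add: algebra_simps)
  qed
  moreover have "?o \<in> mass_dists ?G 1" using \<epsilon> by simp
  ultimately show ?thesis
    by (force simp: social_optima_def is_arg_max_def not_less)
qed

text \<open>The queue earns \<open>(exp \<epsilon> - 1) / \<epsilon>\<close> in both distributions,
  but the optimum spends only mass \<open>\<epsilon>\<close> on it and earns \<open>M\<close> per
  unit on the rest.\<close>

lemma queue_ratio:
  "social_welfare (queue_game \<epsilon> T) (two_masses \<epsilon> (1 - \<epsilon>))
    / social_welfare (queue_game \<epsilon> T) (two_masses 1 0)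
    = 1 + (1 - \<epsilon>) * M * \<epsilon> / (exp \<epsilon> - 1)"
proof -
  have "\<epsilon> * \<epsilon> \<le> \<epsilon>" using \<epsilon> by simp
  then have "min (1 / \<epsilon>\<^sup>2) (1 / \<epsilon>) = 1 / \<epsilon>"
    using \<epsilon> by (intro min_absorb2) (simp add: power2_eq_square frac_le)
  then have eq: "social_welfare (queue_game \<epsilon> T) (two_masses 1 0) = (exp \<epsilon> - 1) / \<epsilon>"
    by (subst queue_welfare) (auto simp: two_masses_def)
  have opt: "social_welfare (queue_game \<epsilon> T) (two_masses \<epsilon> (1 - \<epsilon>))
      = (exp \<epsilon> - 1) / \<epsilon> + M * (1 - \<epsilon>)"
    using \<epsilon> by (subst queue_welfare) (auto simp: two_masses_def power2_eq_square)
  show ?thesis unfolding eq opt using \<epsilon> by (simp add: field_simps)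
qed

end

text \<open>Intermediate value theorem between a small positive \<open>a\<close>, which excludes the
  root 0, and \<open>2 * M\<close>, where the quadratic Taylor term of \<open>exp\<close> already
  equals \<open>M * (2 * M)\<close>.\<close>

lemma exp_minus_one_eq_mult:
  fixes M :: real
  assumes M: "M > 1"
  obtains T where "T > 0" and "exp T - 1 = M * T"
proof -
  let ?g = "\<lambda>t. exp t - 1 - M * t"
  \<comment> \<open>The bound 1 serves the estimate \<open>exp a \<le> 1 + a + a * a\<close>, and
    \<open>M - 1\<close> makes this at most \<open>1 + M * a\<close>.\<close>
  define a where "a = min 1 (M - 1)"
  have a: "0 < a" "a \<le> 1" "a \<le> M - 1" "a \<le> 2 * M" using M by (auto simp: a_def)
  have "exp a \<le> 1 + a + a * a"
    using exp_bound[of a] a by (simp add: power2_eq_square)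
  moreover have "a * a \<le> (M - 1) * a" using a by (intro mult_right_mono) auto
  ultimately have lo: "?g a \<le> 0" by (simp add: algebra_simps)
  have "1 + 2 * M + (2 * M)\<^sup>2 / 2 \<le> exp (2 * M)"
    using M by (intro exp_lower_Taylor_quadratic) auto
  then have "0 \<le> ?g (2 * M)"
    using M by (simp add: power2_eq_square)
  then have "\<exists>t\<ge>a. t \<le> 2 * M \<and> ?g t = 0"
    using lo a by (intro IVT') (auto intro!: continuous_intros)
  then obtain t where "a \<le> t" "?g t = 0" by blast
  with a show thesis by (intro that[of t]) auto
qed

section \<open>The supremum over all instances\<close>

theorem proposition2:
  fixes M :: real
  assumes "M > 1"
  shows "Sup {ereal (social_welfare G \<mu>opt / social_welfare G \<mu>eq) | G \<beta> \<mu>opt \<mu>eq.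
            valid_game G \<and> \<beta> > 0 \<and> util G = exp_discounting \<beta> \<and>
            continuous_sojourn G \<and> rate_monotonous G \<and>
            char_number \<beta> G = ereal M \<and>
            \<mu>opt \<in> social_optima G \<and> \<mu>eq \<in> stationary_equilibria G}
         = ereal (M + 1)"
    (is "Sup ?S = _")
proof (rule antisym)
  show "Sup ?S \<le> ereal (M + 1)"
    by (rule Sup_least) (auto simp: price_of_anarchy_le)
next
  obtain T where T: "T > 0" "exp T - 1 = M * T"
    using exp_minus_one_eq_mult[OF assms] .
  let ?f = "\<lambda>\<epsilon>::real. 1 + (1 - \<epsilon>) * M * \<epsilon> / (exp \<epsilon> - 1)"
  \<comment> \<open>\<open>T\<close> is fixed by \<open>M\<close>; only \<open>\<epsilon>\<close>
    tends to 0, with \<open>(exp \<epsilon> - 1) / \<epsilon>\<close> tending to 1. Each small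
    \<open>\<epsilon>\<close> gives a ratio in the set, so the limit bounds the supremum from
    below.\<close>
  have "(?f \<longlongrightarrow> M + 1) (at_right 0)" by real_asymp
  then have lim: "((\<lambda>\<epsilon>. ereal (?f \<epsilon>)) \<longlongrightarrow> ereal (M + 1)) (at_right 0)" by simp
  have "0 < min 1 (min (M - 1) (1 / M))" using assms by simp
  then have "\<forall>\<^sub>F \<epsilon> in at_right 0. \<epsilon> \<in> {0<..<min 1 (min (M - 1) (1 / M))}"
    by (rule eventually_at_right_real)
  then have "\<forall>\<^sub>F \<epsilon> in at_right 0. ereal (?f \<epsilon>) \<le> Sup ?S"
  proof eventually_elim
    case (elim \<epsilon>)
    then have \<epsilon>: "0 < \<epsilon>" "\<epsilon> \<le> 1" "\<epsilon> \<le> M - 1" "\<epsilon> \<le> 1 / M" by auto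
    note facts = queue_valid[OF \<epsilon> T] queue_continuous[OF \<epsilon> T] queue_rate_monotonous[OF \<epsilon> T]
      queue_char_number[OF \<epsilon> T] queue_optimum[OF \<epsilon> T] queue_equilibrium[OF \<epsilon> T]
      queue_game_sel(4) zero_less_one
    show ?case
      unfolding queue_ratio[OF \<epsilon> T, symmetric]
      using facts by (intro Sup_upper CollectI exI conjI) (rule refl | assumption)+
  qed
  then show "ereal (M + 1) \<le> Sup ?S"
    by (rule tendsto_upperbound[OF lim]) simp
qed

end
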